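(* Consider the bicolored bosonic model with colors $\mathbf c=\{c_1<\dots<c_s\}$ and $r$ dolors $\mathbf d=\{d_1<\dots<d_r\}$, and parameter $z$. Let $\Sigma_h^{\mathrm{bicol}}=\mathbf c\cup\mathbf d$, $\Sigma_v^{\mathrm{bicol}}=\mathbb N^{\mathbf c\times\mathbf d}$, $\Sigma_h^{\mathrm{col}}=\mathbf c\cup\{+\}$, $\Sigma_v^{\mathrm{col}}=\mathbb N^{\mathbf c}$. Let $p_h:\Sigma_h^{\mathrm{bicol}}\to\Sigma_h^{\mathrm{col}}$ be given by $p_h(d_i)=+$, $p_h(c_i)=c_i$, and $p_v:\Sigma_v^{\mathrm{bicol}}\to\Sigma_v^{\mathrm{col}}$ by $p_v(n)(c)=\sum_{d\in\mathbf d}n(c,d)$. Let $(A,B,C,D)\in\Sigma_h^{\mathrm{col}}\times\Sigma_v^{\mathrm{col}}\times\Sigma_h^{\mathrm{col}}\times\Sigma_v^{\mathrm{col}}$, and let $(b,c)\in\Sigma_v^{\mathrm{bicol}}\times\Sigma_h^{\mathrm{bicol}}$ be such that $p_v(b)=B$ and $p_h(c)=C$. Then $$\beta^{\mathrm{col}}(A,B,C,D)=z^{1-r}\sum_{(a,d)\in\Sigma_h^{\mathrm{bicol}}\times\Sigma_v^{\mathrm{bicol}},\ p_h(a)=A,\ p_v(d)=D}\beta^{\mathrm{bicol}}(a,b,c,d),$$ where in $\beta(\cdot,\cdot,\cdot,\cdot)$ the arguments are the spins of the left, top, right and bottom edges of a fused vertex with parameter $z$, in this order.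
   Context: Bicolored weights $\beta^{\mathrm{bicol}}$. An unfused vertex carries a color-dolor label $(c,d)$ and a parameter $z$. Its left and right (horizontal) edges each carry one element of $\mathbf c\cup\mathbf d$; its top and bottom edges each carry a number in $\mathbb N=\{0,1,2,\dots\}$. The admissible configurations and weights ($t$ a global parameter) are: (1) left $=$ right $=x$ a dolor, top $=$ bottom $=n$: weight $1$ if $x=d$; if $x\ne d$, weight $z^{\epsilon}t^{\eta}$ with $\epsilon=1$ if $c=c_1$, else $0$, and $\eta=n$ if $x<d$, else $0$. (2) left $=$ right $=a$ a color, top $=$ bottom $=n$: weight $z$ if $a=c$; $t^n$ if $c>a$; $1$ if $c<a$. (3) left $=d$, right $=c$, top $=n\ge1$, bottom $=n-1$: weight $(1-t^n)/(1-t)=1+t+\dots+t^{n-1}$. (4) left $=c$, right $=d$, top $=n$, bottom $=n+1$: weight $(1-t)z$. All other configurations have weight $0$. Order color-dolor pairs by: $(c,d)<(c',d')$ iff $d>d'$, or $d=d'$ and $c<c'$. A fused vertex is a horizontal row of $sr$ unfused vertices with the same parameter $z$, one for each pair $(c,d)$, placed left to right in increasing order; its vertical edges carry the multiplicities of all pairs. Its weight $\beta^{\mathrm{bicol}}$ is the product of the unfused weights for the unique admissible labelling of internal horizontal edges if one exists, and $0$ otherwise. Colored weights $\beta^{\mathrm{col}}$ (the colored bosonic model of Bump and Naprienko, which is the bicolored model with exactly one dolor, renamed $+$). A fused colored vertex is a horizontal row of $s$ unfused vertices labelled $c_1,\dots,c_s$ from left to right; horizontal spins are in $\mathbf c\cup\{+\}$,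 vertical spins of the vertex labelled $c$ are in $\mathbb N$. Unfused weights for label $c$: left $=$ right $=+$, top $=$ bottom $=n$: $1$; left $=$ right $=a\in\mathbf c$, top $=$ bottom $=n$: $z$ if $a=c$, $t^n$ if $c>a$, $1$ if $c<a$; left $=+$, right $=c$, top $=n\ge1$, bottom $=n-1$: $(1-t^n)/(1-t)$; left $=c$, right $=+$, top $=n$, bottom $=n+1$: $(1-t)z$; all others $0$. $\beta^{\mathrm{col}}$ is the product of these for the unique admissible labelling of internal edges, and $0$ if there is none. *)

theory Defs
  imports Complex_Main "HOL-Library.Cardinality"
begin

text \<open>
  Colors and dolors are the elements of two finite linearly ordered types \<open>'c\<close> and \<open>'d\<close>, so that
  \<open>s = CARD('c)\<close> and \<open>r = CARD('d)\<close> are arbitrary positive numbers.  Horizontal spins are elements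
  of \<open>'c + 'd\<close> (bicolored model: \<open>Inl\<close> for colors, \<open>Inr\<close> for dolors) and of \<open>'c option\<close> (colored
  model: \<open>None\<close> is the spin \<open>+\<close>).  The four spins around a vertex are always listed in the order
  left, top, right, bottom.
\<close>

section \<open>Fusion\<close>

text \<open>
  In a row of vertices with labels \<open>vs\<close>, the list \<open>hs\<close> consists of all the horizontal spins from left
  to right, including the two outer ones.
\<close>

definition admissible_labelling ::
  "('v \<Rightarrow> 'h \<Rightarrow> nat \<Rightarrow> 'h \<Rightarrow> nat \<Rightarrow> bool) \<Rightarrow> 'v list \<Rightarrow>
   'h \<Rightarrow> ('v \<Rightarrow> nat) \<Rightarrow> 'h \<Rightarrow> ('v \<Rightarrow> nat) \<Rightarrow> 'h list \<Rightarrow> bool" where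
  "admissible_labelling adm vs l tp r bt hs \<longleftrightarrow>
     length hs = Suc (length vs) \<and> hs ! 0 = l \<and> hs ! length vs = r \<and>
     (\<forall>i<length vs. adm (vs ! i) (hs ! i) (tp (vs ! i)) (hs ! Suc i) (bt (vs ! i)))"

definition fused_weight ::
  "('v \<Rightarrow> 'h \<Rightarrow> nat \<Rightarrow> 'h \<Rightarrow> nat \<Rightarrow> bool) \<Rightarrow> ('v \<Rightarrow> 'h \<Rightarrow> nat \<Rightarrow> 'h \<Rightarrow> nat \<Rightarrow> 'a::field) \<Rightarrow> 'v list \<Rightarrow>
   'h \<Rightarrow> ('v \<Rightarrow> nat) \<Rightarrow> 'h \<Rightarrow> ('v \<Rightarrow> nat) \<Rightarrow> 'a" where
  "fused_weight adm wt vs l tp r bt =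
     (if \<exists>hs. admissible_labelling adm vs l tp r bt hs
      then let hs = (THE hs. admissible_labelling adm vs l tp r bt hs)
           in \<Prod>i<length vs. wt (vs ! i) (hs ! i) (tp (vs ! i)) (hs ! Suc i) (bt (vs ! i))
      else 0)"

lemma admissible_labelling_unique:
  assumes det: "\<And>v x n y y' m. adm v x n y m \<Longrightarrow> adm v x n y' m \<Longrightarrow> y = y'"
    and hs: "admissible_labelling adm vs l tp r bt hs"
    and hs': "admissible_labelling adm vs l tp r bt hs'"
  shows "hs = hs'"
proof (rule nth_equalityI)
  show "length hs = length hs'"
    using hs hs' by (simp add: admissible_labelling_def)
next
  fix i assume "i < length hs"
  then have "i \<le> length vs"
    using hs by (simp add: admissible_labelling_def)
  then show "hs ! i = hs' ! i"
  proof (induction i)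
    case 0
    show ?case using hs hs' by (simp add: admissible_labelling_def)
  next
    case (Suc i)
    then have "i < length vs" and eq: "hs ! i = hs' ! i" by auto
    then have "adm (vs ! i) (hs ! i) (tp (vs ! i)) (hs ! Suc i) (bt (vs ! i))"
      and "adm (vs ! i) (hs ! i) (tp (vs ! i)) (hs' ! Suc i) (bt (vs ! i))"
      using hs hs' by (auto simp: admissible_labelling_def)
    then show ?case by (rule det)
  qed
qed


section \<open>The bicolored model\<close>

inductive bicol_admissible :: "'c \<times> 'd \<Rightarrow> 'c + 'd \<Rightarrow> nat \<Rightarrow> 'c + 'd \<Rightarrow> nat \<Rightarrow> bool" where
  "bicol_admissible (c, d) (Inr x) n (Inr x) n"
| "bicol_admissible (c, d) (Inl a) n (Inl a) n"
| "bicol_admissible (c, d) (Inr d) (Suc n) (Inl c) n"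
| "bicol_admissible (c, d) (Inl c) n (Inr d) (Suc n)"

text \<open>
  The quotient \<open>(1 - t^n) / (1 - t)\<close> is written as \<open>1 + t + \<dots> + t^(n-1)\<close>, which also covers \<open>t = 1\<close>.
\<close>

fun bicol_weight ::
  "'a::field \<Rightarrow> 'a \<Rightarrow> 'c::{finite,linorder} \<times> 'd::{finite,linorder} \<Rightarrow>
   'c + 'd \<Rightarrow> nat \<Rightarrow> 'c + 'd \<Rightarrow> nat \<Rightarrow> 'a" where
  "bicol_weight t z (c, d) (Inr x) n (Inr y) m =
     (if x = y \<and> n = m
      then if x = d then 1
           else z ^ (if c = Min UNIV then 1 else 0) * t ^ (if x < d then n else 0)
      else 0)"
| "bicol_weight t z (c, d) (Inl a) n (Inl a') m =
     (if a = a' \<and> n = m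
      then if a = c then z else if c > a then t ^ n else 1
      else 0)"
| "bicol_weight t z (c, d) (Inr x) n (Inl a) m =
     (if x = d \<and> a = c \<and> n = Suc m then \<Sum>k<n. t ^ k else 0)"
| "bicol_weight t z (c, d) (Inl a) n (Inr x) m =
     (if a = c \<and> x = d \<and> m = Suc n then (1 - t) * z else 0)"

definition pair_less :: "'c::linorder \<times> 'd::linorder \<Rightarrow> 'c \<times> 'd \<Rightarrow> bool" where
  "pair_less p q \<longleftrightarrow> snd p > snd q \<or> (snd p = snd q \<and> fst p < fst q)"

definition bicol_row :: "('c::{finite,linorder} \<times> 'd::{finite,linorder}) list" where
  "bicol_row = concat (map (\<lambda>d. map (\<lambda>c. (c, d)) (sorted_list_of_set UNIV))
                           (rev (sorted_list_of_set UNIV)))"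

lemma set_bicol_row: "set bicol_row = UNIV"
  by (auto simp: bicol_row_def)

lemma sorted_bicol_row:
  "sorted_wrt pair_less (bicol_row :: ('c::{finite,linorder} \<times> 'd::{finite,linorder}) list)"
proof -
  have "sorted_wrt pair_less (concat (map (\<lambda>d. map (\<lambda>c. (c, d)) cs) ds))"
    if "sorted_wrt (<) cs" "sorted_wrt (>) ds" for cs :: "'c list" and ds :: "'d list"
    using that(2)
  proof (induction ds)
    case (Cons d ds)
    then show ?case
      using that(1) by (auto simp: sorted_wrt_append sorted_wrt_map pair_less_def)
  qed simp
  then show ?thesis
    by (simp add: bicol_row_def sorted_wrt_rev)
qed

lemma bicol_admissible_det:
  "bicol_admissible v x n y m \<Longrightarrow> bicol_admissible v x n y' m \<Longrightarrow> y = y'"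
  by (auto elim!: bicol_admissible.cases)

definition beta_bicol ::
  "'a::field \<Rightarrow> 'a \<Rightarrow> 'c::{finite,linorder} + 'd::{finite,linorder} \<Rightarrow> ('c \<times> 'd \<Rightarrow> nat) \<Rightarrow>
   'c + 'd \<Rightarrow> ('c \<times> 'd \<Rightarrow> nat) \<Rightarrow> 'a" where
  "beta_bicol t z = fused_weight bicol_admissible (bicol_weight t z) bicol_row"


section \<open>The colored model\<close>

inductive col_admissible :: "'c \<Rightarrow> 'c option \<Rightarrow> nat \<Rightarrow> 'c option \<Rightarrow> nat \<Rightarrow> bool" where
  "col_admissible c None n None n"
| "col_admissible c (Some a) n (Some a) n"
| "col_admissible c None (Suc n) (Some c) n"
| "col_admissible c (Some c) n None (Suc n)"

fun col_weight ::
  "'a::field \<Rightarrow> 'a \<Rightarrow> 'c::linorder \<Rightarrow> 'c option \<Rightarrow> nat \<Rightarrow> 'c option \<Rightarrow> nat \<Rightarrow> 'a" where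
  "col_weight t z c None n None m = (if n = m then 1 else 0)"
| "col_weight t z c (Some a) n (Some a') m =
     (if a = a' \<and> n = m
      then if a = c then z else if c > a then t ^ n else 1
      else 0)"
| "col_weight t z c None n (Some a) m =
     (if a = c \<and> n = Suc m then \<Sum>k<n. t ^ k else 0)"
| "col_weight t z c (Some a) n None m =
     (if a = c \<and> m = Suc n then (1 - t) * z else 0)"

lemma col_admissible_det:
  "col_admissible v x n y m \<Longrightarrow> col_admissible v x n y' m \<Longrightarrow> y = y'"
  by (auto elim!: col_admissible.cases)

definition beta_col ::
  "'a::field \<Rightarrow> 'a \<Rightarrow> 'c::{finite,linorder} option \<Rightarrow> ('c \<Rightarrow> nat) \<Rightarrow>
   'c option \<Rightarrow> ('c \<Rightarrow> nat) \<Rightarrow> 'a" where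
  "beta_col t z = fused_weight col_admissible (col_weight t z) (sorted_list_of_set UNIV)"


section \<open>Projection of spins\<close>

fun p_h :: "'c + 'd \<Rightarrow> 'c option" where
  "p_h (Inl c) = Some c"
| "p_h (Inr d) = None"

definition p_v :: "('c \<times> 'd::finite \<Rightarrow> nat) \<Rightarrow> 'c \<Rightarrow> nat" where
  "p_v n c = (\<Sum>d\<in>UNIV. n (c, d))"

lemma finite_fibre:
  fixes A :: "'c::finite option" and D :: "'c \<Rightarrow> nat"
  shows "finite {(a :: 'c + 'd::finite, d :: 'c \<times> 'd \<Rightarrow> nat). p_h a = A \<and> p_v d = D}"
proof (rule finite_subset)
  let ?S = "{d :: 'c \<times> 'd \<Rightarrow> nat.
    \<forall>x. (x \<in> UNIV \<longrightarrow> d x \<in> {..Max (range D)}) \<and> (x \<notin> UNIV \<longrightarrow> d x = 0)}"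
  have "d xy \<le> Max (range (p_v d))" for d :: "'c \<times> 'd \<Rightarrow> nat" and xy
  proof (cases xy)
    case (Pair x y)
    have "d (x, y) \<le> p_v d x"
      unfolding p_v_def by (rule member_le_sum) auto
    also have "p_v d x \<le> Max (range (p_v d))"
      by (rule Max_ge) auto
    finally show ?thesis by (simp add: Pair)
  qed
  then show "{(a :: 'c + 'd, d :: 'c \<times> 'd \<Rightarrow> nat). p_h a = A \<and> p_v d = D} \<subseteq> UNIV \<times> ?S"
    by blast
  have "finite ?S"
    by (rule finite_set_of_finite_funs) auto
  then show "finite ((UNIV :: ('c + 'd) set) \<times> ?S)"
    by simp
qed

end

(* Read a row from right to left, with its top and right spins fixed, and sum over the left and
   bottom spins, recording only the left spin and the displacement, i.e. the projected bottom minus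
   the projected top.  Up to a power of z, the total weight depends only on the projections, which
   is proved by adding the dolors one at a time.  A right color, or a right dolor already passed,
   contributes z^(k-1) times the colored weight for the tops summed over the k dolors so far.
   Adding the vertices of the next dolor d acts as the colored model on colors and d, and by a
   scalar on each other dolor, so the step is an identity between explicit colored weights, which
   comes down to telescoping sums of (1 - t^n(c)) * t^(sum of n(c') over c' > c). *)

theory Submission
  imports Defs "HOL-Library.Function_Algebras"
begin

section \<open>Fused weights vertex by vertex\<close>

definition deterministic :: "('v \<Rightarrow> 'h \<Rightarrow> nat \<Rightarrow> 'h \<Rightarrow> nat \<Rightarrow> bool) \<Rightarrow> bool" where
  "deterministic adm \<longleftrightarrow> (\<forall>v x n y y' m. adm v x n y m \<longrightarrow> adm v x n y' m \<longrightarrow> y = y')"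

lemma deterministicD:
  "deterministic adm \<Longrightarrow> adm v x n y m \<Longrightarrow> adm v x n y' m \<Longrightarrow> y = y'"
  by (auto simp: deterministic_def)

lemma admissible_labelling_Nil:
  "admissible_labelling adm [] l tp r bt hs \<longleftrightarrow> hs = [l] \<and> l = r"
  by (auto simp: admissible_labelling_def length_Suc_conv)

lemma admissible_labelling_Cons:
  "admissible_labelling adm (v # vs) l tp r bt hs \<longleftrightarrow>
     (\<exists>m hs'. hs = l # hs' \<and> adm v l (tp v) m (bt v) \<and> admissible_labelling adm vs m tp r bt hs')"
  (is "?L \<longleftrightarrow> ?R")
proof
  assume L: ?L
  then obtain hs' where hs: "hs = l # hs'"
    by (cases hs) (auto simp: admissible_labelling_def)
  have "adm v l (tp v) (hs' ! 0) (bt v) \<and> admissible_labelling adm vs (hs' ! 0) tp r bt hs'"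
    using L unfolding hs admissible_labelling_def by (auto simp: All_less_Suc2)
  then show ?R using hs by blast
next
  assume ?R
  then show ?L
    unfolding admissible_labelling_def by (auto simp: All_less_Suc2)
qed

lemma fused_weight_Nil:
  "fused_weight adm wt [] l tp r bt = of_bool (l = r)"
  by (auto simp: fused_weight_def admissible_labelling_Nil)

lemma fused_weight_eq:
  assumes det: "deterministic adm"
    and hs: "admissible_labelling adm vs l tp r bt hs"
  shows "fused_weight adm wt vs l tp r bt =
    (\<Prod>i<length vs. wt (vs ! i) (hs ! i) (tp (vs ! i)) (hs ! Suc i) (bt (vs ! i)))"
proof -
  have "(THE hs. admissible_labelling adm vs l tp r bt hs) = hs"
    using hs admissible_labelling_unique[of adm, OF deterministicD[OF det]] by (intro the_equality) blast+
  then show ?thesis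
    using hs by (auto simp: fused_weight_def)
qed

text \<open>By determinism the first internal spin can only be \<open>m\<close>, so labellings of
  the longer row correspond to labellings of \<open>vs\<close> with left spin
  \<open>m\<close>.\<close>

lemma fused_weight_Cons:
  assumes det: "deterministic adm"
    and adm: "adm v l (tp v) m (bt v)"
  shows "fused_weight adm wt (v # vs) l tp r bt =
    wt v l (tp v) m (bt v) * fused_weight adm wt vs m tp r bt"
proof (cases "\<exists>hs. admissible_labelling adm vs m tp r bt hs")
  case True
  then obtain hs where hs: "admissible_labelling adm vs m tp r bt hs" ..
  then have 0: "hs ! 0 = m"
    by (simp add: admissible_labelling_def)
  have "admissible_labelling adm (v # vs) l tp r bt (l # hs)"
    using adm hs by (auto simp: admissible_labelling_Cons)
  then show ?thesis
    by (simp add: fused_weight_eq[OF det] fused_weight_eq[OF det hs] prod.lessThan_Suc_shift 0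
        del: prod.lessThan_Suc)
next
  case False
  then have "\<not> (\<exists>hs. admissible_labelling adm (v # vs) l tp r bt hs)"
    using deterministicD[OF det adm] by (auto simp: admissible_labelling_Cons)
  with False show ?thesis
    by (simp add: fused_weight_def)
qed

lemma fused_weight_Cons_eq_0:
  assumes "\<And>m. \<not> adm v l (tp v) m (bt v)"
  shows "fused_weight adm wt (v # vs) l tp r bt = 0"
  using assms by (simp add: fused_weight_def admissible_labelling_Cons)

text \<open>Lets the bottom spin of a vertex be reset once that vertex has been split off the
  row.\<close>

lemma fused_weight_cong:
  assumes "\<And>v. v \<in> set vs \<Longrightarrow> bt v = bt' v"
  shows "fused_weight adm wt vs l tp r bt = fused_weight adm wt vs l tp r bt'"
proof -
  have "admissible_labelling adm vs l tp r bt = admissible_labelling adm vs l tp r bt'"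
    using assms by (auto simp: admissible_labelling_def fun_eq_iff)
  then show ?thesis
    using assms by (simp add: fused_weight_def Let_def)
qed


section \<open>Summing over the bottom edges\<close>

text \<open>Integer-valued, because a row may lower spins. The map \<open>\<pi>\<close> is
  \<open>id\<close> in the colored model and \<open>fst\<close> in the bicolored one, where it
  forgets the dolor.\<close>

definition displacement :: "('v::finite \<Rightarrow> 'c) \<Rightarrow> ('v \<Rightarrow> nat) \<Rightarrow> ('v \<Rightarrow> nat) \<Rightarrow> 'c \<Rightarrow> int" where
  "displacement \<pi> tp bt c = (\<Sum>v | \<pi> v = c. int (bt v) - int (tp v))"

definition unit_at :: "'c \<Rightarrow> 'c \<Rightarrow> int" where
  "unit_at c = (\<lambda>x. of_bool (x = c))"

lemma displacement_self [simp]: "displacement \<pi> tp tp = 0"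
  by (simp add: fun_eq_iff displacement_def)

lemma displacement_fun_upd:
  fixes bt :: "'v::finite \<Rightarrow> nat"
  shows "displacement \<pi> tp (bt(v := k)) c =
    displacement \<pi> tp bt c + (int k - int (bt v)) * unit_at (\<pi> v) c"
proof (cases "\<pi> v = c")
  case True
  have "displacement \<pi> tp f c = int (f v) - int (tp v) +
      (\<Sum>u \<in> {u. \<pi> u = c} - {v}. int (f u) - int (tp u))" for f
    unfolding displacement_def using True by (subst sum.remove[of _ v]) auto
  from this[of bt] this[of "bt(v := k)"] show ?thesis
    using True by (simp add: unit_at_def)
next
  case False
  then have "displacement \<pi> tp (bt(v := k)) c = displacement \<pi> tp bt c"
    unfolding displacement_def by (intro sum.cong) auto
  with False show ?thesis
    by (simp add: unit_at_def)
qed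

text \<open>
  Bottom spins off the row are frozen to the top ones, so that the displacement of all of \<open>bt\<close> is the
  one created by the row.
\<close>

definition bottoms :: "('v::finite \<Rightarrow> 'c) \<Rightarrow> 'v list \<Rightarrow> ('v \<Rightarrow> nat) \<Rightarrow> ('c \<Rightarrow> int) \<Rightarrow> ('v \<Rightarrow> nat) set"
  where "bottoms \<pi> vs tp \<delta> =
    {bt. (\<forall>v. v \<notin> set vs \<longrightarrow> bt v = tp v) \<and> displacement \<pi> tp bt = \<delta>}"

text \<open>The right spin comes early, so that a partial application is a function of the row, the
  left spin and the displacement: the shape of \<open>F\<close> in the recursion for blocks.\<close>

definition row_sum ::
  "('v \<Rightarrow> 'h \<Rightarrow> nat \<Rightarrow> 'h \<Rightarrow> nat \<Rightarrow> bool) \<Rightarrow> ('v \<Rightarrow> 'h \<Rightarrow> nat \<Rightarrow> 'h \<Rightarrow> nat \<Rightarrow> 'a::field) \<Rightarrow>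
   ('v::finite \<Rightarrow> 'c) \<Rightarrow> ('v \<Rightarrow> nat) \<Rightarrow> 'h \<Rightarrow> 'v list \<Rightarrow> 'h \<Rightarrow> ('c \<Rightarrow> int) \<Rightarrow> 'a" where
  "row_sum adm wt \<pi> tp r vs l \<delta> = (\<Sum>bt\<in>bottoms \<pi> vs tp \<delta>. fused_weight adm wt vs l tp r bt)"

text \<open>A bottom spin is at most the sum of the bottoms over its fibre, and that sum is fixed by
  \<open>\<delta>\<close> and \<open>tp\<close>.\<close>

lemma finite_bottoms:
  fixes \<pi> :: "'v::finite \<Rightarrow> 'c"
  shows "finite (bottoms \<pi> vs tp \<delta>)"
proof (rule finite_subset)
  let ?M = "\<lambda>v. nat (\<delta> (\<pi> v) + (\<Sum>u | \<pi> u = \<pi> v. int (tp u)))"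
  let ?S = "{bt :: 'v \<Rightarrow> nat. \<forall>v. (v \<in> UNIV \<longrightarrow> bt v \<in> {..Max (range ?M)}) \<and> (v \<notin> UNIV \<longrightarrow> bt v = 0)}"
  have "bt v \<le> Max (range ?M)" if "bt \<in> bottoms \<pi> vs tp \<delta>" for bt v
  proof -
    have \<delta>: "\<delta> = displacement \<pi> tp bt"
      using that by (simp add: bottoms_def)
    have "int (bt v) \<le> (\<Sum>u | \<pi> u = \<pi> v. int (bt u))"
      by (rule member_le_sum) auto
    then have "bt v \<le> ?M v"
      unfolding \<delta> displacement_def by (simp add: sum_subtractf)
    also have "\<dots> \<le> Max (range ?M)"
      by (rule Max_ge) auto
    finally show ?thesis .
  qed
  then show "bottoms \<pi> vs tp \<delta> \<subseteq> ?S"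
    by blast
  show "finite ?S"
    by (rule finite_set_of_finite_funs) auto
qed

lemma row_sum_Nil:
  "row_sum adm wt \<pi> tp r [] l \<delta> = of_bool (l = r \<and> \<delta> = 0)"
proof -
  have "bottoms \<pi> [] tp \<delta> = (if \<delta> = 0 then {tp} else {})"
    by (auto simp: bottoms_def simp flip: fun_eq_iff)
  then show ?thesis
    by (simp add: row_sum_def fused_weight_Nil)
qed

text \<open>Resetting \<open>bt v\<close> to \<open>tp v\<close> is a bijection onto the bottoms of
  the shorter row. It lowers the displacement by \<open>k - tp v\<close> at \<open>\<pi> v\<close>
  and does not affect the weight of \<open>vs\<close>.\<close>

lemma sum_bottoms_Cons:
  assumes "v \<notin> set vs"
    and \<delta>': "\<And>c. \<delta>' c = \<delta> c - (int k - int (tp v)) * unit_at (\<pi> v) c"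
  shows "(\<Sum>bt | bt \<in> bottoms \<pi> (v # vs) tp \<delta> \<and> bt v = k. fused_weight adm wt vs m tp r bt) =
    row_sum adm wt \<pi> tp r vs m \<delta>'"
  unfolding row_sum_def
proof (rule sum.reindex_bij_witness[where i = "\<lambda>bt. bt(v := k)" and j = "\<lambda>bt. bt(v := tp v)"])
  fix bt assume bt: "bt \<in> {bt \<in> bottoms \<pi> (v # vs) tp \<delta>. bt v = k}"
  then show "bt(v := tp v, v := k) = bt" by auto
  have "displacement \<pi> tp (bt(v := tp v)) = \<delta>'"
    using bt by (auto simp: fun_eq_iff displacement_fun_upd \<delta>' bottoms_def algebra_simps)
  then show "bt(v := tp v) \<in> bottoms \<pi> vs tp \<delta>'"
    using bt by (auto simp: bottoms_def)
  show "fused_weight adm wt vs m tp r (bt(v := tp v)) = fused_weight adm wt vs m tp r bt"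
    using assms(1) by (intro fused_weight_cong) auto
next
  fix bt assume bt: "bt \<in> bottoms \<pi> vs tp \<delta>'"
  then have tp: "bt v = tp v"
    using assms(1) by (auto simp: bottoms_def)
  then show "bt(v := k, v := tp v) = bt" by auto
  have "displacement \<pi> tp (bt(v := k)) = \<delta>"
    using bt tp \<delta>' by (auto simp: fun_eq_iff displacement_fun_upd bottoms_def)
  then show "bt(v := k) \<in> {bt \<in> bottoms \<pi> (v # vs) tp \<delta>. bt v = k}"
    using bt by (auto simp: bottoms_def)
qed

text \<open>Bottoms are sorted by their value at \<open>v\<close>. The set \<open>T\<close> lists
  the possible right and bottom spins of the first vertex, at most two pairs in either
  model.\<close>

lemma row_sum_Cons:
  assumes det: "deterministic adm"
    and v: "v \<notin> set vs"
    and T: "finite T" "\<And>m k. (m, k) \<in> T \<longleftrightarrow> adm v l (tp v) m k"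
  shows "row_sum adm wt \<pi> tp r (v # vs) l \<delta> =
    (\<Sum>(m, k)\<in>T. wt v l (tp v) m k *
       row_sum adm wt \<pi> tp r vs m (\<lambda>c. \<delta> c - (int k - int (tp v)) * unit_at (\<pi> v) c))"
proof -
  have *: "fused_weight adm wt (v # vs) l tp r bt =
      (\<Sum>(m, k)\<in>T. if bt v = k then wt v l (tp v) m k * fused_weight adm wt vs m tp r bt else 0)"
    for bt
  proof (cases "\<exists>m. adm v l (tp v) m (bt v)")
    case True
    then obtain m where m: "adm v l (tp v) m (bt v)" ..
    \<comment> \<open>The bottom spin determines the right spin, so only the pair
      \<open>(m, bt v)\<close> contributes.\<close>
    have "(\<Sum>(m, k)\<in>T. if bt v = k then wt v l (tp v) m k * fused_weight adm wt vs m tp r bt else 0) =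
      (\<Sum>p\<in>T. if p = (m, bt v) then wt v l (tp v) m (bt v) * fused_weight adm wt vs m tp r bt else 0)"
      using T(2) deterministicD[OF det _ m] by (intro sum.cong) (auto split: if_splits)
    also have "\<dots> = wt v l (tp v) m (bt v) * fused_weight adm wt vs m tp r bt"
      using T m by simp
    finally show ?thesis
      by (simp add: fused_weight_Cons[of adm v l tp m bt, OF det m])
  next
    case False
    then have "(\<Sum>(m, k)\<in>T. if bt v = k then wt v l (tp v) m k * fused_weight adm wt vs m tp r bt else 0) = 0"
      using T by (intro sum.neutral) auto
    with False show ?thesis
      by (simp add: fused_weight_Cons_eq_0)
  qed
  have "row_sum adm wt \<pi> tp r (v # vs) l \<delta> =
    (\<Sum>(m, k)\<in>T. \<Sum>bt\<in>bottoms \<pi> (v # vs) tp \<delta>.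
       if bt v = k then wt v l (tp v) m k * fused_weight adm wt vs m tp r bt else 0)"
    unfolding row_sum_def * by (subst sum.swap) (simp add: case_prod_beta)
  also have "\<dots> = (\<Sum>(m, k)\<in>T. wt v l (tp v) m k *
      (\<Sum>bt | bt \<in> bottoms \<pi> (v # vs) tp \<delta> \<and> bt v = k. fused_weight adm wt vs m tp r bt))"
    by (simp add: sum.inter_filter finite_bottoms sum_distrib_left if_distrib cong: if_cong)
  finally show ?thesis
    by (simp add: sum_bottoms_Cons[OF v])
qed


section \<open>Blocks of vertices\<close>

definition q_number :: "'a::field \<Rightarrow> nat \<Rightarrow> 'a" where
  "q_number t n = (\<Sum>k<n. t ^ k)"

lemma q_number_0 [simp]: "q_number t 0 = 0"
  by (simp add: q_number_def)

text \<open>Merges the top of a color at a new dolor with its total over the earlier dolors.\<close>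

lemma q_number_add: "q_number t (m + n) = q_number t m + t ^ m * q_number t n"
proof (induction n)
  case (Suc n)
  then show ?case
    by (simp add: q_number_def power_add algebra_simps)
qed simp

lemma one_minus_times_q_number: "(1 - t) * q_number t n = 1 - t ^ n"
  by (simp add: q_number_def one_diff_power_eq)

text \<open>If \<open>s\<close> is the sum of \<open>n\<close> over the elements of \<open>V\<close>
  above \<open>c\<close>, the summand times \<open>1 - t\<close> is
  \<open>t ^ s - t ^ (s + n c)\<close>, and consecutive exponents match. Inserting a new minimum
  leaves the other exponents unchanged.\<close>

lemma sum_q_number_telescope:
  fixes n :: "'c::linorder \<Rightarrow> nat"
  assumes "finite V"
  shows "(1 - t) * (\<Sum>c\<in>V. q_number t (n c) * t ^ sum n {c'\<in>V. c < c'}) = 1 - t ^ sum n V"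
  using assms
proof (induction V rule: finite_linorder_min_induct)
  case (insert b V)
  have b: "{c'. (c' = b \<or> c' \<in> V) \<and> b < c'} = V"
    using insert.hyps by auto
  have c: "{c'. (c' = b \<or> c' \<in> V) \<and> c < c'} = {c'\<in>V. c < c'}" if "c \<in> V" for c
    using insert.hyps that by auto
  have "b \<notin> V"
    using insert.hyps by auto
  have "(\<Sum>c\<in>insert b V. q_number t (n c) * t ^ sum n {c'\<in>insert b V. c < c'}) =
      q_number t (n b) * t ^ sum n V + (\<Sum>c\<in>V. q_number t (n c) * t ^ sum n {c'\<in>V. c < c'})"
    using insert.hyps \<open>b \<notin> V\<close> by (simp add: b c)
  then have "(1 - t) * (\<Sum>c\<in>insert b V. q_number t (n c) * t ^ sum n {c'\<in>insert b V. c < c'}) =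
      ((1 - t) * q_number t (n b)) * t ^ sum n V + (1 - t ^ sum n V)"
    by (simp only: distrib_left insert.IH mult.assoc)
  also have "\<dots> = 1 - t ^ sum n (insert b V)"
    unfolding one_minus_times_q_number using insert.hyps \<open>b \<notin> V\<close>
    by (simp add: power_add algebra_simps)
  finally show ?case .
qed simp

text \<open>Every exponent contains the common part \<open>sum n U\<close>, which factors out and
  leaves the telescoping sum over \<open>V\<close>. The intervals of colors needed later are
  instances.\<close>

lemma sum_q_number:
  fixes n :: "'c::{finite,linorder} \<Rightarrow> nat"
  assumes up: "\<And>c. c \<in> V \<Longrightarrow> {c<..} = {c'\<in>V. c < c'} \<union> U" and disj: "V \<inter> U = {}"
  shows "(1 - t) * (\<Sum>c\<in>V. q_number t (n c) * t ^ sum n {c<..}) =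
    t ^ sum n U - t ^ sum n (V \<union> U)"
proof -
  have "sum n {c<..} = sum n {c'\<in>V. c < c'} + sum n U" if "c \<in> V" for c
    unfolding up[OF that] using disj by (intro sum.union_disjoint) auto
  then have "(\<Sum>c\<in>V. q_number t (n c) * t ^ sum n {c<..}) =
      (\<Sum>c\<in>V. q_number t (n c) * t ^ sum n {c'\<in>V. c < c'}) * t ^ sum n U"
    by (simp add: sum_distrib_right power_add mult.assoc)
  then have "(1 - t) * (\<Sum>c\<in>V. q_number t (n c) * t ^ sum n {c<..}) =
      (1 - t ^ sum n V) * t ^ sum n U"
    by (simp only: sum_q_number_telescope[OF finite] flip: mult.assoc)
  also have "sum n (V \<union> U) = sum n V + sum n U"
    using disj by (intro sum.union_disjoint) auto
  then have "(1 - t ^ sum n V) * t ^ sum n U = t ^ sum n U - t ^ sum n (V \<union> U)"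
    by (simp add: power_add left_diff_distrib)
  finally show ?thesis .
qed

lemma sum_q_number_all:
  fixes n :: "'c::{finite,linorder} \<Rightarrow> nat"
  shows "(1 - t) * (\<Sum>c\<in>UNIV. q_number t (n c) * t ^ sum n {c<..}) = 1 - t ^ sum n UNIV"
proof -
  have "{c<..} = {c'\<in>UNIV. c < c'} \<union> {}" for c :: 'c
    by auto
  from sum_q_number[OF this, of t n] show ?thesis by simp
qed

lemma sum_q_number_greater:
  fixes n :: "'c::{finite,linorder} \<Rightarrow> nat"
  shows "(1 - t) * (\<Sum>c\<in>{a<..}. q_number t (n c) * t ^ sum n {c<..}) = 1 - t ^ sum n {a<..}"
proof -
  have "{c<..} = {c'\<in>{a<..}. c < c'} \<union> {}" if "c \<in> {a<..}" for c
    using that by auto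
  from sum_q_number[OF this, of t n] show ?thesis by simp
qed

lemma sum_q_number_less:
  fixes n :: "'c::{finite,linorder} \<Rightarrow> nat"
  shows "(1 - t) * (\<Sum>c\<in>{..<a}. q_number t (n c) * t ^ sum n {c<..}) =
    t ^ sum n {a..} - t ^ sum n UNIV"
proof -
  have "{c<..} = {c'\<in>{..<a}. c < c'} \<union> {a..}" if "c \<in> {..<a}" for c
    using that by auto
  moreover have "{..<a} \<inter> {a..} = {}" "{..<a} \<union> {a..} = UNIV"
    by auto
  ultimately show ?thesis
    using sum_q_number[of "{..<a}" "{a..}" t n] by simp
qed

lemma sum_q_number_between:
  fixes n :: "'c::{finite,linorder} \<Rightarrow> nat"
  assumes "a < b"
  shows "(1 - t) * (\<Sum>c\<in>{a<..<b}. q_number t (n c) * t ^ sum n {c<..}) =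
    t ^ sum n {b..} - t ^ sum n {a<..}"
proof -
  have "{c<..} = {c'\<in>{a<..<b}. c < c'} \<union> {b..}" if "c \<in> {a<..<b}" for c
    using that by auto
  moreover have "{a<..<b} \<inter> {b..} = {}" "{a<..<b} \<union> {b..} = {a<..}"
    using assms by auto
  ultimately show ?thesis
    using sum_q_number[of "{a<..<b}" "{b..}" t n] by metis
qed

text \<open>
  Both models satisfy this recursion along a row of vertices with a common dolor \<open>d\<close>, where \<open>None\<close>
  stands for \<open>+\<close> or \<open>d\<close>, and \<open>F cs x \<delta>\<close> is the total weight of the configurations with left spin
  \<open>x\<close> and displacement \<open>\<delta>\<close> when the row starts with the labels \<open>cs\<close>.
\<close>

locale block_recursion =
  fixes t z :: "'a::field" and n :: "'c::{finite,linorder} \<Rightarrow> nat" and e :: "'c \<Rightarrow> 'g::ab_group_add"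
    and F :: "'c list \<Rightarrow> 'c option \<Rightarrow> 'g \<Rightarrow> 'a"
  assumes None: "c \<notin> set cs \<Longrightarrow>
      F (c # cs) None \<delta> = F cs None \<delta> + q_number t (n c) * F cs (Some c) (\<delta> + e c)"
    and same: "c \<notin> set cs \<Longrightarrow>
      F (c # cs) (Some c) \<delta> = z * F cs (Some c) \<delta> + (1 - t) * z * F cs None (\<delta> - e c)"
    and other: "c \<notin> set cs \<Longrightarrow> a \<noteq> c \<Longrightarrow>
      F (c # cs) (Some a) \<delta> = t ^ (if a < c then n c else 0) * F cs (Some a) \<delta>"
begin

section \<open>Closed formulas for the vertices of one dolor\<close>

lemma Some_notin_sorted:
  assumes "sorted_wrt (<) cs" and "a \<notin> set cs"
  shows "F cs (Some a) \<delta> = t ^ sum n {c\<in>set cs. a < c} * F [] (Some a) \<delta>"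
  using assms
proof (induction cs)
  case (Cons b cs)
  have "{c'. (c' = b \<or> c' \<in> set cs) \<and> a < c'} =
      (if a < b then insert b {c'\<in>set cs. a < c'} else {c'\<in>set cs. a < c'})"
    by auto
  with Cons show ?case
    by (auto simp: other power_add)
qed simp

text \<open>Either \<open>+\<close> runs through, or it becomes \<open>c\<close> at the vertex
  labelled \<open>c\<close>. All later labels exceed \<open>c\<close>, so \<open>c\<close> then runs
  to the end, collecting a power of \<open>t\<close> at each of them.\<close>

lemma None_sorted:
  assumes "sorted_wrt (<) cs"
  shows "F cs None \<delta> = F [] None \<delta> +
    (\<Sum>c\<in>set cs. q_number t (n c) * t ^ sum n {c'\<in>set cs. c < c'} * F [] (Some c) (\<delta> + e c))"
  using assms
proof (induction cs)
  case (Cons b cs)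
  then have b: "b \<notin> set cs" and srt: "sorted_wrt (<) cs"
    by auto
  have up_b: "{c'. (c' = b \<or> c' \<in> set cs) \<and> b < c'} = set cs" "{c \<in> set cs. b < c} = set cs"
    using Cons.prems by auto
  have up: "{c'. (c' = b \<or> c' \<in> set cs) \<and> c < c'} = {c'\<in>set cs. c < c'}" if "c \<in> set cs" for c
    using Cons.prems that by force
  show ?case
    using b by (simp add: None Cons.IH[OF srt] Some_notin_sorted[OF srt] up_b up mult.assoc)
qed simp

text \<open>Labels before \<open>a\<close> are smaller and contribute 1. At its own vertex the color
  goes straight on or is released downwards, leaving \<open>+\<close>; in the latter case the
  formula for \<open>+\<close> applies to the remaining, larger labels.\<close>

lemma Some_sorted:
  assumes "sorted_wrt (<) cs" and "a \<in> set cs"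
  shows "F cs (Some a) \<delta> = z * t ^ sum n {c\<in>set cs. a < c} * F [] (Some a) \<delta> +
    (1 - t) * z * (F [] None (\<delta> - e a) +
      (\<Sum>c | c \<in> set cs \<and> a < c. q_number t (n c) * t ^ sum n {c'\<in>set cs. c < c'} *
         F [] (Some c) (\<delta> - e a + e c)))"
  using assms
proof (induction cs)
  case (Cons b cs)
  then have b: "b \<notin> set cs" and srt: "sorted_wrt (<) cs"
    by auto
  have up: "{c'. (c' = b \<or> c' \<in> set cs) \<and> c < c'} = {c'\<in>set cs. c < c'}" if "c \<in> set cs" for c
    using Cons.prems that by force
  show ?case
  proof (cases "a = b")
    case True
    have "{c'. (c' = b \<or> c' \<in> set cs) \<and> b < c'} = set cs" "{c \<in> set cs. b < c} = set cs"
      using Cons.prems by auto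
    then show ?thesis
      using b by (simp add: True same Some_notin_sorted[OF srt] None_sorted[OF srt] up mult.assoc)
  next
    case False
    with Cons.prems have a: "a \<in> set cs" "\<not> a < b"
      by force+
    then have "{c'. (c' = b \<or> c' \<in> set cs) \<and> a < c'} = {c'\<in>set cs. a < c'}"
      by auto
    then show ?thesis
      using b a False by (simp add: other Cons.IH[OF srt a(1)] up)
  qed
qed simp

lemma None_all: "F (sorted_list_of_set UNIV) None \<delta> = F [] None \<delta> +
    (\<Sum>c\<in>UNIV. q_number t (n c) * t ^ sum n {c<..} * F [] (Some c) (\<delta> + e c))"
  by (subst None_sorted) (simp_all add: greaterThan_def)

lemma Some_all: "F (sorted_list_of_set UNIV) (Some a) \<delta> =
    z * t ^ sum n {a<..} * F [] (Some a) \<delta> +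
    (1 - t) * z * (F [] None (\<delta> - e a) +
      (\<Sum>c\<in>{a<..}. q_number t (n c) * t ^ sum n {c<..} * F [] (Some c) (\<delta> - e a + e c)))"
  by (subst Some_sorted) (simp_all add: greaterThan_def)

end

text \<open>The value of \<open>beta_col\<close> as a function of the displacement \<open>\<delta> = D - B\<close>.\<close>

fun col_value :: "'a::field \<Rightarrow> 'a \<Rightarrow> ('c::{finite,linorder} \<Rightarrow> 'g::ab_group_add) \<Rightarrow> ('c \<Rightarrow> nat) \<Rightarrow>
   'c option \<Rightarrow> 'c option \<Rightarrow> 'g \<Rightarrow> 'a" where
  "col_value t z e B None None \<delta> = of_bool (\<delta> = 0)"
| "col_value t z e B None (Some a) \<delta> = (1 - t) * z * of_bool (\<delta> = e a)"
| "col_value t z e B (Some c) None \<delta> =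
     q_number t (B c) * t ^ sum B {c<..} * of_bool (\<delta> + e c = 0)"
| "col_value t z e B (Some c) (Some a) \<delta> =
     (if a = c then z * t ^ sum B {c<..} * of_bool (\<delta> = 0)
      else if a < c
      then (1 - t) * z * q_number t (B c) * t ^ sum B {c<..} * of_bool (\<delta> + e c = e a)
      else 0)"


section \<open>The colored weights when a new dolor adds its tops\<close>

lemma sum_atLeast:
  fixes n :: "'c::{finite,linorder} \<Rightarrow> nat"
  shows "sum n {a..} = n a + sum n {a<..}"
proof -
  have "{a..} = insert a {a<..}"
    by auto
  then show ?thesis by simp
qed

text \<open>The induction step for left dolors: earlier ones cross the new block, the new one turns
  into a color \<open>c\<close>. For a right color \<open>a\<close> only \<open>c \<le> a\<close>
  contribute: the colors below \<open>a\<close> telescope and reduce the first term to the exponent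
  \<open>sum n {a..}\<close>, and \<open>c = a\<close> supplies the other half of
  \<open>q_number_add\<close>.\<close>

lemma col_value_add_None:
  fixes t z :: "'a::field" and n :: "'c::{finite,linorder} \<Rightarrow> nat" and e :: "'c \<Rightarrow> 'g::ab_group_add"
  shows "z * t ^ sum n UNIV * col_value t z e B C None \<delta> +
      (\<Sum>c\<in>UNIV. q_number t (n c) * t ^ sum n {c<..} * col_value t z e B C (Some c) (\<delta> + e c)) =
    z * col_value t z e (\<lambda>c. n c + B c) C None \<delta>"
proof (cases C)
  case None
  have "(\<Sum>c\<in>UNIV. q_number t (n c) * t ^ sum n {c<..} * col_value t z e B None (Some c) (\<delta> + e c)) =
      ((1 - t) * (\<Sum>c\<in>UNIV. q_number t (n c) * t ^ sum n {c<..})) * z * of_bool (\<delta> = 0)"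
    by (simp add: sum_distrib_left sum_distrib_right mult_ac)
  then show ?thesis
    unfolding sum_q_number_all by (simp add: None algebra_simps)
next
  case (Some a)
  let ?w = "\<lambda>c. q_number t (n c) * t ^ sum n {c<..}"
  let ?b = "of_bool (\<delta> + e a = 0) :: 'a"
  \<comment> \<open>The color absorbed in the new block is released again later, so \<open>c\<close>
    cancels from the displacement.\<close>
  have *: "\<delta> + e c + e a = e c \<longleftrightarrow> \<delta> + e a = 0" for c
    by (metis add.commute add.left_commute add_cancel_left_right)
  have "(\<Sum>c\<in>UNIV. ?w c * col_value t z e B (Some a) (Some c) (\<delta> + e c)) =
      (\<Sum>c\<in>{..<a}. ?w c * col_value t z e B (Some a) (Some c) (\<delta> + e c)) +
      ?w a * col_value t z e B (Some a) (Some a) (\<delta> + e a)"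
    by (subst sum.mono_neutral_right[of _ "insert a {..<a}"]) auto
  also have "\<dots> = ((1 - t) * (\<Sum>c\<in>{..<a}. ?w c)) * (z * q_number t (B a) * t ^ sum B {a<..}) * ?b +
      ?w a * (z * t ^ sum B {a<..}) * ?b"
    unfolding sum_distrib_left sum_distrib_right
    by (intro arg_cong2[where f = "(+)"] sum.cong) (auto simp: *)
  finally show ?thesis
    unfolding sum_q_number_less by (simp add: Some sum_atLeast q_number_add sum.distrib power_add,
        simp add: algebra_simps)
qed

text \<open>The induction step for a left color \<open>a\<close>, which crosses the new block or is
  replaced there by some \<open>c > a\<close>. It can exit as a color \<open>b\<close> only if
  \<open>a \<le> b\<close>; for \<open>a < b\<close> the colors strictly between telescope, and
  \<open>c = b\<close> completes \<open>q_number_add\<close>.\<close>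

lemma col_value_add_Some:
  fixes t z :: "'a::field" and n :: "'c::{finite,linorder} \<Rightarrow> nat" and e :: "'c \<Rightarrow> 'g::ab_group_add"
  shows "z * t ^ sum n {a<..} * col_value t z e B C (Some a) \<delta> +
      (1 - t) * z * (\<Sum>c\<in>{a<..}. q_number t (n c) * t ^ sum n {c<..} *
        col_value t z e B C (Some c) (\<delta> - e a + e c)) =
    z * col_value t z e (\<lambda>c. n c + B c) C (Some a) \<delta>"
proof (cases C)
  case None
  have "(\<Sum>c\<in>{a<..}. q_number t (n c) * t ^ sum n {c<..} *
      col_value t z e B None (Some c) (\<delta> - e a + e c)) =
      ((1 - t) * (\<Sum>c\<in>{a<..}. q_number t (n c) * t ^ sum n {c<..})) * z * of_bool (\<delta> = e a)"
    by (simp add: sum_distrib_left sum_distrib_right mult_ac)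
  note this[unfolded sum_q_number_greater]
  then show ?thesis
    unfolding None by (simp only:) (simp add: algebra_simps)
next
  case (Some b)
  let ?w = "\<lambda>c. q_number t (n c) * t ^ sum n {c<..}"
  let ?f = "\<lambda>c. ?w c * col_value t z e B (Some b) (Some c) (\<delta> - e a + e c)"
  consider "b < a" | "a = b" | "a < b"
    by force
  then show ?thesis
  proof cases
    case 1
    then have "sum ?f {a<..} = 0"
      by (intro sum.neutral) auto
    with 1 show ?thesis
      by (auto simp: Some)
  next
    case 2
    then have "sum ?f {a<..} = 0"
      by (intro sum.neutral) auto
    with 2 show ?thesis
      by (simp add: Some sum.distrib power_add)
  next
    case 3
    let ?b = "of_bool (\<delta> + e b = e a) :: 'a"
    have *: "\<delta> - e a + e c + e b = e c \<longleftrightarrow> \<delta> + e b = e a" "\<delta> - e a + e b = 0 \<longleftrightarrow> \<delta> + e b = e a" for c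
      by (auto simp: algebra_simps)
    have "sum ?f {a<..} = sum ?f {a<..<b} + ?f b"
      using 3 by (subst sum.mono_neutral_right[of _ "insert b {a<..<b}"]) auto
    also have "\<dots> =
        ((1 - t) * (\<Sum>c\<in>{a<..<b}. ?w c)) * (z * q_number t (B b) * t ^ sum B {b<..}) * ?b +
        ?w b * (z * t ^ sum B {b<..}) * ?b"
      unfolding sum_distrib_left sum_distrib_right
      by (intro arg_cong2[where f = "(+)"] sum.cong) (auto simp: *)
    finally have "sum ?f {a<..} = (t ^ sum n {b..} - t ^ sum n {a<..}) *
        (z * q_number t (B b) * t ^ sum B {b<..}) * ?b + ?w b * (z * t ^ sum B {b<..}) * ?b"
      unfolding sum_q_number_between[OF 3] .
    then show ?thesis
      unfolding Some using 3
      by (simp only:) (simp add: sum_atLeast q_number_add sum.distrib power_add, auto simp: algebra_simps)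
  qed
qed


section \<open>The colored model\<close>

lemma deterministic_col: "deterministic col_admissible"
  unfolding deterministic_def by (blast dest: col_admissible_det)

text \<open>At top 0 there is nothing to absorb. An explicit set of pairs is what
  \<open>row_sum_Cons\<close> takes as \<open>T\<close>.\<close>

lemma col_admissible_None:
  "col_admissible c None n m k \<longleftrightarrow> (m, k) \<in> {(None, n)} \<union> (if n = 0 then {} else {(Some c, n - 1)})"
  by (auto elim: col_admissible.cases intro: col_admissible.intros simp: gr0_conv_Suc)

lemma col_admissible_Some:
  "col_admissible c (Some a) n m k \<longleftrightarrow>
     (m, k) \<in> {(Some a, n)} \<union> (if a = c then {(None, Suc n)} else {})"
  by (auto elim: col_admissible.cases intro: col_admissible.intros)

text \<open>Absorbing \<open>c\<close> lowers the bottom spin by one, so the rest of the row must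
  account for \<open>\<delta> + unit_at c\<close>; releasing \<open>c\<close> gives the opposite
  sign.\<close>

lemma col_block_recursion:
  fixes B :: "'c::{finite,linorder} \<Rightarrow> nat"
  shows "block_recursion t z B unit_at (row_sum col_admissible (col_weight t z) id B C)"
proof
  fix c :: 'c and cs and \<delta> :: "'c \<Rightarrow> int"
  assume c: "c \<notin> set cs"
  show "row_sum col_admissible (col_weight t z) id B C (c # cs) None \<delta> =
      row_sum col_admissible (col_weight t z) id B C cs None \<delta> +
      q_number t (B c) * row_sum col_admissible (col_weight t z) id B C cs (Some c) (\<delta> + unit_at c)"
    by (subst row_sum_Cons[OF deterministic_col c _ col_admissible_None[symmetric]])
      (auto simp: q_number_def plus_fun_def of_nat_diff)
  show "row_sum col_admissible (col_weight t z) id B C (c # cs) (Some c) \<delta> =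
      z * row_sum col_admissible (col_weight t z) id B C cs (Some c) \<delta> +
      (1 - t) * z * row_sum col_admissible (col_weight t z) id B C cs None (\<delta> - unit_at c)"
    by (subst row_sum_Cons[OF deterministic_col c _ col_admissible_Some[symmetric]])
      (auto simp: fun_diff_def)
  fix a assume "a \<noteq> c"
  then show "row_sum col_admissible (col_weight t z) id B C (c # cs) (Some a) \<delta> =
      t ^ (if a < c then B c else 0) * row_sum col_admissible (col_weight t z) id B C cs (Some a) \<delta>"
    by (subst row_sum_Cons[OF deterministic_col c _ col_admissible_Some[symmetric]])
      (auto simp: fun_diff_def)
qed

text \<open>With \<open>id\<close> as projection the displacement determines the bottoms, so the row
  sum has a single term, and the closed formulas evaluate it. In \<open>col_value\<close> the right
  spin precedes the left one.\<close>

lemma beta_col_eq: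
  fixes B :: "'c::{finite,linorder} \<Rightarrow> nat"
  shows "beta_col t z A B C D = col_value t z unit_at B C A (\<lambda>c. int (D c) - int (B c))"
proof -
  let ?cs = "sorted_list_of_set UNIV :: 'c list"
  let ?\<delta> = "\<lambda>c. int (D c) - int (B c)"
  interpret block_recursion t z B unit_at "row_sum col_admissible (col_weight t z) id B C"
    by (rule col_block_recursion)
  have "displacement id B D' c = int (D' c) - int (B c)" for D' c
    by (simp add: displacement_def)
  then have "bottoms id ?cs B ?\<delta> = {D}"
    by (auto simp: bottoms_def fun_eq_iff)
  then have "beta_col t z A B C D = row_sum col_admissible (col_weight t z) id B C ?cs A ?\<delta>"
    by (simp add: row_sum_def beta_col_def)
  also have "\<dots> = col_value t z unit_at B C A ?\<delta>"
  proof (cases A)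
    case None
    \<comment> \<open>A conditional on \<open>c = a\<close> makes the sum over \<open>c\<close>
      collapse to the right spin.\<close>
    have *: "f * of_bool (Some c = Some a \<and> \<delta> + unit_at c = 0) =
        (if c = a then f * of_bool (\<delta> + unit_at a = 0) else 0)"
      for f :: 'a and c a and \<delta> :: "'c \<Rightarrow> int"
      by auto
    show ?thesis
      unfolding None None_all row_sum_Nil by (cases C) (simp_all add: * del: option.inject sum_mult_of_bool_eq)
  next
    case (Some a)
    have *: "f * of_bool (Some c = Some b \<and> \<delta> - unit_at a + unit_at c = 0) =
        (if c = b then f * of_bool (\<delta> + unit_at b = unit_at a) else 0)"
      for f :: 'a and c b and \<delta> :: "'c \<Rightarrow> int"
      by (auto simp: algebra_simps)
    show ?thesis
      unfolding Some Some_all row_sum_Nil by (cases C) (auto simp: * simp del: option.inject sum_mult_of_bool_eq)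
  qed
  finally show ?thesis .
qed


section \<open>The bicolored model\<close>

lemma deterministic_bicol: "deterministic bicol_admissible"
  unfolding deterministic_def by (blast dest: bicol_admissible_det)

lemma bicol_admissible_Inr:
  "bicol_admissible (c, d) (Inr x) n m k \<longleftrightarrow>
     (m, k) \<in> {(Inr x, n)} \<union> (if x = d \<and> n \<noteq> 0 then {(Inl c, n - 1)} else {})"
  by (auto elim: bicol_admissible.cases intro: bicol_admissible.intros simp: gr0_conv_Suc)

lemma bicol_admissible_Inl:
  "bicol_admissible (c, d) (Inl a) n m k \<longleftrightarrow>
     (m, k) \<in> {(Inl a, n)} \<union> (if a = c then {(Inr d, Suc n)} else {})"
  by (auto elim: bicol_admissible.cases intro: bicol_admissible.intros)

section \<open>Bicolored row sums with fixed top and right spins, block by block\<close>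

context
  fixes t z :: "'a::field" and b :: "'c::{finite,linorder} \<times> 'd::{finite,linorder} \<Rightarrow> nat"
    and y :: "'c + 'd"
begin

abbreviation bicol_sum :: "('c \<times> 'd) list \<Rightarrow> 'c + 'd \<Rightarrow> ('c \<Rightarrow> int) \<Rightarrow> 'a" where
  "bicol_sum \<equiv> row_sum bicol_admissible (bicol_weight t z) fst b y"

definition block :: "'d \<Rightarrow> ('c \<times> 'd) list" where
  "block d = map (\<lambda>c. (c, d)) (sorted_list_of_set UNIV)"

definition blocks :: "'d list \<Rightarrow> ('c \<times> 'd) list" where
  "blocks ds = concat (map block ds)"

lemma blocks_simps [simp]:
  "blocks [] = []" "blocks (d # ds) = block d @ blocks ds"
  by (simp_all add: blocks_def)

lemma set_blocks: "set (blocks ds) = UNIV \<times> set ds"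
  by (auto simp: blocks_def block_def)

text \<open>When a color or \<open>d\<close> enters, the vertices of dolor \<open>d\<close> only
  exchange colors with \<open>d\<close>, with the weights of the colored model; \<open>None\<close>
  stands for \<open>d\<close>.\<close>

lemma bicol_block_recursion:
  assumes vs: "\<And>c. (c, d) \<notin> set vs"
  shows "block_recursion t z (\<lambda>c. b (c, d)) unit_at
    (\<lambda>cs x. bicol_sum (map (\<lambda>c. (c, d)) cs @ vs) (case x of None \<Rightarrow> Inr d | Some a \<Rightarrow> Inl a))"
proof
  fix c :: 'c and cs and \<delta> :: "'c \<Rightarrow> int"
  assume "c \<notin> set cs"
  with vs have c: "(c, d) \<notin> set (map (\<lambda>c. (c, d)) cs @ vs)"
    by auto
  note Inr = row_sum_Cons[OF deterministic_bicol c _ bicol_admissible_Inr[symmetric]]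
    and Inl = row_sum_Cons[OF deterministic_bicol c _ bicol_admissible_Inl[symmetric]]
  show "bicol_sum (map (\<lambda>c. (c, d)) (c # cs) @ vs) (case None of None \<Rightarrow> Inr d | Some a \<Rightarrow> Inl a) \<delta> =
      bicol_sum (map (\<lambda>c. (c, d)) cs @ vs) (case None of None \<Rightarrow> Inr d | Some a \<Rightarrow> Inl a) \<delta> +
      q_number t (b (c, d)) * bicol_sum (map (\<lambda>c. (c, d)) cs @ vs)
        (case Some c of None \<Rightarrow> Inr d | Some a \<Rightarrow> Inl a) (\<delta> + unit_at c)"
    by (simp only: option.case list.map append_Cons, subst Inr) (auto simp: q_number_def plus_fun_def of_nat_diff)
  show "bicol_sum (map (\<lambda>c. (c, d)) (c # cs) @ vs) (case Some c of None \<Rightarrow> Inr d | Some a \<Rightarrow> Inl a) \<delta> =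
      z * bicol_sum (map (\<lambda>c. (c, d)) cs @ vs) (case Some c of None \<Rightarrow> Inr d | Some a \<Rightarrow> Inl a) \<delta> +
      (1 - t) * z * bicol_sum (map (\<lambda>c. (c, d)) cs @ vs)
        (case None of None \<Rightarrow> Inr d | Some a \<Rightarrow> Inl a) (\<delta> - unit_at c)"
    by (simp only: option.case list.map append_Cons, subst Inl) (auto simp: fun_diff_def)
  fix a assume "a \<noteq> c"
  then show "bicol_sum (map (\<lambda>c. (c, d)) (c # cs) @ vs)
        (case Some a of None \<Rightarrow> Inr d | Some a \<Rightarrow> Inl a) \<delta> =
      t ^ (if a < c then b (c, d) else 0) * bicol_sum (map (\<lambda>c. (c, d)) cs @ vs)
        (case Some a of None \<Rightarrow> Inr d | Some a \<Rightarrow> Inl a) \<delta>"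
    by (simp only: option.case list.map append_Cons, subst Inl) (auto simp: fun_diff_def)
qed

lemma bicol_sum_block_same_dolor:
  assumes "\<And>c. (c, d) \<notin> set vs"
  shows "bicol_sum (block d @ vs) (Inr d) \<delta> = bicol_sum vs (Inr d) \<delta> +
    (\<Sum>c\<in>UNIV. q_number t (b (c, d)) * t ^ (\<Sum>c'\<in>{c<..}. b (c', d)) *
       bicol_sum vs (Inl c) (\<delta> + unit_at c))"
  using block_recursion.None_all[OF bicol_block_recursion[OF assms]]
  by (simp add: block_def)

lemma bicol_sum_block_color:
  assumes "\<And>c. (c, d) \<notin> set vs"
  shows "bicol_sum (block d @ vs) (Inl a) \<delta> =
    z * t ^ (\<Sum>c\<in>{a<..}. b (c, d)) * bicol_sum vs (Inl a) \<delta> +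
    (1 - t) * z * (bicol_sum vs (Inr d) (\<delta> - unit_at a) +
      (\<Sum>c\<in>{a<..}. q_number t (b (c, d)) * t ^ (\<Sum>c'\<in>{c<..}. b (c', d)) *
         bicol_sum vs (Inl c) (\<delta> - unit_at a + unit_at c)))"
  using block_recursion.Some_all[OF bicol_block_recursion[OF assms]]
  by (simp add: block_def)

text \<open>A dolor other than \<open>d\<close> cannot turn in the block. The factor
  \<open>z\<close> comes from the smallest color only, hence once per block.\<close>

lemma bicol_sum_block_other_dolor:
  assumes vs: "\<And>c. (c, d) \<notin> set vs" and x: "x \<noteq> d"
  shows "bicol_sum (block d @ vs) (Inr x) \<delta> =
    z * t ^ (if x < d then \<Sum>c\<in>UNIV. b (c, d) else 0) * bicol_sum vs (Inr x) \<delta>"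
proof -
  let ?w = "\<lambda>c. (if c = Min UNIV then z else 1) * t ^ (if x < d then b (c, d) else 0)"
  have "bicol_sum (map (\<lambda>c. (c, d)) cs @ vs) (Inr x) \<delta> = prod ?w (set cs) * bicol_sum vs (Inr x) \<delta>"
    if "distinct cs" for cs
    using that
  proof (induction cs)
    case (Cons c cs)
    then have c: "(c, d) \<notin> set (map (\<lambda>c. (c, d)) cs @ vs)"
      using vs by auto
    have "bicol_sum (map (\<lambda>c. (c, d)) (c # cs) @ vs) (Inr x) \<delta> =
        ?w c * bicol_sum (map (\<lambda>c. (c, d)) cs @ vs) (Inr x) \<delta>"
      by (simp only: list.map append_Cons,
          subst row_sum_Cons[OF deterministic_bicol c _ bicol_admissible_Inr[symmetric]])
        (use x in auto)
    with Cons show ?case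
      by simp
  qed simp
  from this[of "sorted_list_of_set UNIV"] show ?thesis
    by (simp add: block_def prod.distrib power_sum)
qed

text \<open>The left dolor exceeds all dolors of the row, so it crosses each block with weight
  \<open>z\<close> and no power of \<open>t\<close>.\<close>

lemma bicol_sum_passive_dolor:
  assumes "sorted_wrt (>) ds" and "\<And>d'. d' \<in> set ds \<Longrightarrow> d' < d"
  shows "bicol_sum (blocks ds) (Inr d) \<delta> = z ^ length ds * of_bool (y = Inr d \<and> \<delta> = 0)"
  using assms
proof (induction ds)
  case (Cons d' ds)
  then have "\<And>c. (c, d') \<notin> set (blocks ds)" "d \<noteq> d'" "\<not> d < d'"
    by (fastforce simp: set_blocks)+
  with Cons show ?case
    by (simp add: bicol_sum_block_other_dolor)
qed (auto simp: row_sum_Nil)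

text \<open>No vertex of the row can produce \<open>x\<close>, so a right spin \<open>x\<close> must
  have entered on the left.\<close>

lemma bicol_sum_passive_right:
  assumes y: "y = Inr x" and "distinct ds" and "x \<notin> set ds"
  shows "bicol_sum (blocks ds) (Inl a) \<delta> = 0"
    and "x' \<noteq> x \<Longrightarrow> bicol_sum (blocks ds) (Inr x') \<delta> = 0"
proof -
  have "(\<forall>a \<delta>. bicol_sum (blocks ds) (Inl a) \<delta> = 0) \<and>
      (\<forall>x' \<delta>. x' \<noteq> x \<longrightarrow> bicol_sum (blocks ds) (Inr x') \<delta> = 0)"
    using assms(2,3)
  proof (induction ds)
    case (Cons d ds)
    then have d: "\<And>c. (c, d) \<notin> set (blocks ds)" and "d \<noteq> x"
      by (auto simp: set_blocks)
    have "bicol_sum (blocks (d # ds)) (Inr x') \<delta> = 0" if "x' \<noteq> x" for x' \<delta>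
      using Cons that
      by (cases "x' = d") (simp_all add: bicol_sum_block_same_dolor[OF d]
          bicol_sum_block_other_dolor[OF d])
    then show ?case
      using Cons \<open>d \<noteq> x\<close> by (simp add: bicol_sum_block_color[OF d])
  qed (simp add: row_sum_Nil y)
  then show "bicol_sum (blocks ds) (Inl a) \<delta> = 0"
    and "x' \<noteq> x \<Longrightarrow> bicol_sum (blocks ds) (Inr x') \<delta> = 0"
    by blast+
qed

text \<open>The factor \<open>z\<close> on the left avoids the exponent
  \<open>length ds - 1\<close>, so that the induction can start at the empty list. Both halves are
  proved together because a block mixes dolors and colors. As \<open>ds\<close> decreases, each step
  puts a larger dolor at the left end.\<close>

lemma bicol_sum_blocks:
  assumes "sorted_wrt (>) ds" and "\<And>x. y = Inr x \<Longrightarrow> x \<in> set ds"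
  defines "B \<equiv> \<lambda>ds c. \<Sum>d\<in>set ds. b (c, d)"
  shows "z * (\<Sum>x\<in>set ds. bicol_sum (blocks ds) (Inr x) \<delta>) =
      z ^ length ds * col_value t z unit_at (B ds) (p_h y) None \<delta>" (is "?N ds \<delta>")
    and "z * bicol_sum (blocks ds) (Inl a) \<delta> =
      z ^ length ds * col_value t z unit_at (B ds) (p_h y) (Some a) \<delta>" (is "?S ds a \<delta>")
proof -
  have "(\<forall>\<delta>. ?N ds \<delta>) \<and> (\<forall>a \<delta>. ?S ds a \<delta>)"
    using assms(1,2)
  proof (induction ds)
    case Nil
    \<comment> \<open>With no dolor in the list the right spin is a color. All totals are 0, so
      \<open>col_value\<close> vanishes unless the left spin is that color.\<close>
    then obtain a where "y = Inl a"
      by (cases y) auto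
    then show ?case
      by (auto simp: row_sum_Nil B_def)
  next
    case (Cons d ds)
    then have d: "\<And>c. (c, d) \<notin> set (blocks ds)" and less: "\<And>x. x \<in> set ds \<Longrightarrow> x < d"
      and "d \<notin> set ds" and sorted: "sorted_wrt (>) ds"
      by (auto simp: set_blocks)
    have B: "B (d # ds) = (\<lambda>c. b (c, d) + B ds c)"
      using \<open>d \<notin> set ds\<close> by (simp add: B_def fun_eq_iff)
    have distinct: "distinct ds"
      using sorted by (induction ds) auto
    have "bicol_sum (block d @ blocks ds) (Inr x) \<delta> =
        z * t ^ (\<Sum>c\<in>UNIV. b (c, d)) * bicol_sum (blocks ds) (Inr x) \<delta>" if "x \<in> set ds" for x \<delta>
      using less[OF that] by (simp add: bicol_sum_block_other_dolor[OF d])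
    \<comment> \<open>The new dolor runs through its block or turns into a color; each earlier dolor
      is smaller than \<open>d\<close> and crosses with the full power of \<open>t\<close>.\<close>
    then have N: "(\<Sum>x\<in>set (d # ds). bicol_sum (blocks (d # ds)) (Inr x) \<delta>) =
        bicol_sum (blocks ds) (Inr d) \<delta> +
        (z * t ^ (\<Sum>c\<in>UNIV. b (c, d)) * (\<Sum>x\<in>set ds. bicol_sum (blocks ds) (Inr x) \<delta>) +
        (\<Sum>c\<in>UNIV. q_number t (b (c, d)) * t ^ (\<Sum>c'\<in>{c<..}. b (c', d)) *
           bicol_sum (blocks ds) (Inl c) (\<delta> + unit_at c)))" for \<delta>
      using \<open>d \<notin> set ds\<close> by (simp add: bicol_sum_block_same_dolor[OF d] sum_distrib_left)
    show ?case
    proof (cases "y = Inr d")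
      \<comment> \<open>The induction hypothesis does not cover the right spin \<open>d\<close>, but
        the old row can only let \<open>d\<close> pass, so its sums vanish for every other left
        spin.\<close>
      case True
      then have [simp]: "p_h y = None"
        by simp
      have [simp]: "bicol_sum (blocks ds) (Inr d) \<delta> = z ^ length ds * of_bool (\<delta> = 0)" for \<delta>
        using True by (subst bicol_sum_passive_dolor[OF sorted less]) auto
      note [simp] = bicol_sum_passive_right[OF True distinct \<open>d \<notin> set ds\<close>]
      have "x \<noteq> d" if "x \<in> set ds" for x
        using less[OF that] by simp
      then have [simp]: "(\<Sum>x\<in>set ds. bicol_sum (blocks ds) (Inr x) \<delta>) = 0" for \<delta>
        by (intro sum.neutral) simp
      show ?thesis
        unfolding N by (simp add: bicol_sum_block_color[OF d])
    next
      case False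
      \<comment> \<open>Entering the old row as \<open>d\<close> would force \<open>d\<close> out on
        the right.\<close>
      then have [simp]: "bicol_sum (blocks ds) (Inr d) \<delta> = 0" for \<delta>
        by (simp add: bicol_sum_passive_dolor[OF sorted less])
      have IH: "?N ds \<delta>" "?S ds a \<delta>" for a \<delta>
        using Cons False sorted by auto
      let ?E = "col_value t z unit_at (B ds) (p_h y)"
      have "?N (d # ds) \<delta>" for \<delta>
      proof -
        let ?w = "\<lambda>c. q_number t (b (c, d)) * t ^ (\<Sum>c'\<in>{c<..}. b (c', d))"
        have "z * (\<Sum>x\<in>set (d # ds). bicol_sum (blocks (d # ds)) (Inr x) \<delta>) =
          z * t ^ (\<Sum>c\<in>UNIV. b (c, d)) * (z * (\<Sum>x\<in>set ds. bicol_sum (blocks ds) (Inr x) \<delta>)) +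
          (\<Sum>c\<in>UNIV. ?w c * (z * bicol_sum (blocks ds) (Inl c) (\<delta> + unit_at c)))"
          unfolding N by (simp add: distrib_left sum_distrib_left mult_ac)
        also have "\<dots> = z ^ length ds * (z * t ^ (\<Sum>c\<in>UNIV. b (c, d)) * ?E None \<delta> +
          (\<Sum>c\<in>UNIV. ?w c * ?E (Some c) (\<delta> + unit_at c)))"
          unfolding IH by (simp add: distrib_left sum_distrib_left mult_ac)
        also have "\<dots> = z ^ length (d # ds) * col_value t z unit_at (B (d # ds)) (p_h y) None \<delta>"
          unfolding col_value_add_None B by simp
        finally show ?thesis .
      qed
      moreover have "?S (d # ds) a \<delta>" for a \<delta>
      proof -
        let ?w = "\<lambda>c. q_number t (b (c, d)) * t ^ (\<Sum>c'\<in>{c<..}. b (c', d))"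
        have "z * bicol_sum (blocks (d # ds)) (Inl a) \<delta> =
          z * t ^ (\<Sum>c\<in>{a<..}. b (c, d)) * (z * bicol_sum (blocks ds) (Inl a) \<delta>) +
          (1 - t) * z * (\<Sum>c\<in>{a<..}. ?w c * (z * bicol_sum (blocks ds) (Inl c) (\<delta> - unit_at a + unit_at c)))"
          by (simp add: bicol_sum_block_color[OF d] distrib_left sum_distrib_left mult_ac)
        also have "\<dots> = z ^ length ds * (z * t ^ (\<Sum>c\<in>{a<..}. b (c, d)) * ?E (Some a) \<delta> +
          (1 - t) * z * (\<Sum>c\<in>{a<..}. ?w c * ?E (Some c) (\<delta> - unit_at a + unit_at c)))"
          unfolding IH by (simp add: distrib_left sum_distrib_left mult_ac)
        also have "\<dots> = z ^ length (d # ds) * col_value t z unit_at (B (d # ds)) (p_h y) (Some a) \<delta>"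
          using col_value_add_Some[where n = "\<lambda>c. b (c, d)" and e = unit_at and B = "B ds"
              and C = "p_h y" and a = a and t = t and z = z and \<delta> = \<delta>]
          by (simp only: B) simp
        finally show ?thesis .
      qed
      ultimately show ?thesis by blast
    qed
  qed
  then show "?N ds \<delta>" and "?S ds a \<delta>" by blast+
qed

end

section \<open>From the row of all dolors to the theorem\<close>

lemma bicol_row_eq_blocks: "bicol_row = blocks (rev (sorted_list_of_set UNIV))"
  by (simp add: bicol_row_def blocks_def block_def [abs_def])

text \<open>The row contains every pair, so no bottom is frozen, and the displacement along
  \<open>fst\<close> is the difference of the projections under \<open>p_v\<close>.\<close>

lemma bicol_sum_bicol_row:
  fixes b :: "'c::{finite,linorder} \<times> 'd::{finite,linorder} \<Rightarrow> nat"
  shows "bicol_sum t z b y bicol_row x (\<lambda>c. int (D c) - int (p_v b c)) =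
    (\<Sum>d | p_v d = D. beta_bicol t z x b y d)"
proof -
  have "displacement fst b bt c = int (p_v bt c) - int (p_v b c)" for bt and c :: 'c
  proof -
    have "{v :: 'c \<times> 'd. fst v = c} = Pair c ` UNIV"
      by force
    then show ?thesis
      unfolding displacement_def p_v_def by (simp only:) (simp add: sum.reindex inj_on_def sum_subtractf)
  qed
  then have "bottoms fst bicol_row b (\<lambda>c. int (D c) - int (p_v b c)) = {d. p_v d = D}"
    by (auto simp: bottoms_def fun_eq_iff set_bicol_row)
  then show ?thesis
    by (simp add: row_sum_def beta_bicol_def)
qed

theorem proposition6p1:
  fixes t z :: "'a::field"
    and A C :: "'c::{finite,linorder} option"
    and B D :: "'c \<Rightarrow> nat"
    and b :: "'c \<times> 'd::{finite,linorder} \<Rightarrow> nat"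
    and c :: "'c + 'd"
  assumes "z \<noteq> 0"
    and "p_v b = B"
    and "p_h c = C"
  shows "beta_col t z A B C D =
    z powi (1 - int CARD('d)) *
    (\<Sum>(a, d) \<in> {(a :: 'c + 'd, d :: 'c \<times> 'd \<Rightarrow> nat). p_h a = A \<and> p_v d = D}.
       beta_bicol t z a b c d)"
proof -
  let ?\<delta> = "\<lambda>c. int (D c) - int (B c)"
  let ?ds = "rev (sorted_list_of_set UNIV) :: 'd list"
  let ?R = "\<lambda>a. bicol_sum t z b c (blocks ?ds) a ?\<delta>"
  \<comment> \<open>Left spin and bottoms vary independently, so the inner sum is a row sum.\<close>
  have fibre: "{(a, d). p_h a = A \<and> p_v d = D} = {a. p_h a = A} \<times> {d. p_v d = D}"
    by auto
  have "(\<Sum>(a, d) \<in> {(a, d). p_h a = A \<and> p_v d = D}. beta_bicol t z a b c d) =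
      (\<Sum>a | p_h a = A. ?R a)"
    unfolding fibre
    by (simp add: bicol_sum_bicol_row[symmetric] sum.cartesian_product[symmetric] assms(2)[symmetric]
        flip: bicol_row_eq_blocks)
  moreover have "z * (\<Sum>a | p_h a = A. ?R a) = z ^ CARD('d) * beta_col t z A B C D"
  proof -
    have "sorted_wrt (>) ?ds"
      by (simp add: sorted_wrt_rev)
    \<comment> \<open>Every dolor lies in the row, so the condition on the right spin holds for any
      \<open>c\<close>.\<close>
    note * = bicol_sum_blocks[where ds = ?ds, OF this, where y = c and b = b and t = t and z = z and \<delta> = ?\<delta>]
    have B: "(\<lambda>x. \<Sum>d\<in>set ?ds. b (x, d)) = B"
      using assms(2) by (simp add: p_v_def fun_eq_iff)
    show ?thesis
    proof (cases A)
      case None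
      \<comment> \<open>The left spin \<open>+\<close> stands for all dolors, which is the first
        half of \<open>bicol_sum_blocks\<close>; a left color is the second half.\<close>
      have "{a. p_h a = A} = Inr ` (UNIV :: 'd set)"
        using None by (auto simp: image_iff elim: p_h.elims)
      then show ?thesis
        using *(1) None assms(3) B by (simp add: beta_col_eq sum.reindex inj_on_def)
    next
      case (Some a)
      have "{a. p_h a = A} = {Inl a :: 'c + 'd}"
        using Some by (auto elim: p_h.elims)
      then show ?thesis
        using *(2)[of a] Some assms(3) B by (simp add: beta_col_eq)
    qed
  qed
  ultimately show ?thesis
    using assms(1) by (simp add: power_int_diff field_simps)
qed

end
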